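(* Let $d,K,r,p\ge1$ be integers with $r\le d$, and $D=\binom{d+p-1}{p}$. Let $\mathcal V\subset\mathbb R^d$ be a union of $K$ linear subspaces each of dimension $r$, and let $\mathcal S\subset\mathbb R^D$ be its $p$-th order tensorized subspace. Then $\mathcal S$ is $R$-dimensional, where $$R\ \le\ \min\left\{K\binom{r+p-1}{p},\,D\right\}.$$
   Context: For $x\in\mathbb R^d$, $x^{\otimes p}\in\mathbb R^D$ with $D=\binom{d+p-1}{p}$ denotes the vector whose coordinates are indexed by tuples $1\le k_1\le\cdots\le k_p\le d$, the coordinate $(k_1,\dots,k_p)$ being $x_{k_1}\cdots x_{k_p}$ (the distinct entries of the $p$-fold Kronecker product of $x$ with itself). The $p$-th order tensorized subspace of $\mathcal V\subset\mathbb R^d$ is $\mathcal S=\operatorname{span}\{x^{\otimes p}:x\in\mathcal V\}\subset\mathbb R^D$. *)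

theory Defs
  imports "HOL-Analysis.Analysis" "HOL-Analysis.Finite_Function_Topology" "HOL-Library.Multiset"
begin

text \<open>
  The index type \<open>'d\<close> is any finite linear order, playing the role of \<open>{1,\<dots>,d}\<close> with
  \<open>d = CARD('d)\<close>; a tuple \<open>k\<^sub>1 \<le> \<dots> \<le> k\<^sub>p\<close> is a sorted list of length \<open>p\<close>.
\<close>

definition sorted_tuples :: "nat \<Rightarrow> 'd::{finite,linorder} list set" where
  "sorted_tuples p = {ks. length ks = p \<and> sorted ks}"

text \<open>
  The space \<open>\<real>\<^sup>D\<close>, with coordinates indexed by \<^term>\<open>sorted_tuples p\<close>.  As \<open>D\<close> depends on the
  number \<open>p\<close>, it is a subspace of the real vector space of finitely supported functions on
  lists, rather than a type of its own.
\<close>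

definition tensor_space :: "nat \<Rightarrow> ('d::{finite,linorder} list \<Rightarrow>\<^sub>0 real) set" where
  "tensor_space p = {f. Poly_Mapping.keys f \<subseteq> sorted_tuples p}"

definition tensor_pow :: "nat \<Rightarrow> real ^ 'd::{finite,linorder} \<Rightarrow> ('d list \<Rightarrow>\<^sub>0 real)" where
  "tensor_pow p x =
     Abs_poly_mapping (\<lambda>ks. if ks \<in> sorted_tuples p then (\<Prod>k\<leftarrow>ks. x $ k) else 0)"

definition tensorized_subspace ::
    "nat \<Rightarrow> (real ^ 'd::{finite,linorder}) set \<Rightarrow> ('d list \<Rightarrow>\<^sub>0 real) set" where
  "tensorized_subspace p V = span {tensor_pow p x | x. x \<in> V}"

lemma finite_sorted_tuples: "finite (sorted_tuples p :: 'd::{finite,linorder} list set)"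
  by (rule finite_subset[OF _ finite_lists_length_eq[of "UNIV :: 'd set" p]])
     (auto simp: sorted_tuples_def)

lemma card_sorted_tuples:
  "card (sorted_tuples p :: 'd::{finite,linorder} list set) = (CARD('d) + p - 1) choose p"
proof -
  have "bij_betw mset (sorted_tuples p :: 'd list set) (multisets_of_size UNIV p)"
    by (rule bij_betw_byWitness[where f' = sorted_list_of_multiset])
       (auto simp: sorted_tuples_def multisets_of_size_def sorted_sort_id
             simp flip: size_mset)
  then show ?thesis
    by (simp add: bij_betw_same_card card_multisets_of_size)
qed

lemma lookup_tensor_pow:
  "Poly_Mapping.lookup (tensor_pow p x) ks =
     (if ks \<in> sorted_tuples p then (\<Prod>k\<leftarrow>ks. x $ k) else 0)"
proof -
  have "finite {ks. (if ks \<in> sorted_tuples p then (\<Prod>k\<leftarrow>ks. x $ k) else 0) \<noteq> 0}"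
    by (rule finite_subset[OF _ finite_sorted_tuples[of p]]) auto
  then show ?thesis
    unfolding tensor_pow_def by (subst lookup_Abs_poly_mapping) auto
qed

lemma tensor_pow_in_tensor_space: "tensor_pow p x \<in> tensor_space p"
  by (auto simp: tensor_space_def in_keys_iff lookup_tensor_pow split: if_splits)

lemma lookup_scaleR_poly_mapping:
  fixes f :: "'a \<Rightarrow>\<^sub>0 real"
  shows "Poly_Mapping.lookup (c *\<^sub>R f) i = c * Poly_Mapping.lookup f i"
proof -
  have "finite {i. c *\<^sub>R Poly_Mapping.lookup f i \<noteq> 0}"
    by (rule finite_subset[OF _ finite_keys[of f]]) (auto simp: in_keys_iff)
  then show ?thesis
    by (simp add: scaleR_poly_mapping_def)
qed

lemma subspace_tensor_space: "subspace (tensor_space p)"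
proof (rule subspaceI)
  fix f g :: "'a list \<Rightarrow>\<^sub>0 real"
  assume "f \<in> tensor_space p" "g \<in> tensor_space p"
  then show "f + g \<in> tensor_space p"
    using keys_add[of f g] by (auto simp: tensor_space_def)
qed (auto simp: tensor_space_def in_keys_iff lookup_scaleR_poly_mapping)

lemma tensorized_subspace_subset: "tensorized_subspace p V \<subseteq> tensor_space p"
  unfolding tensorized_subspace_def
  by (rule span_minimal) (auto simp: tensor_pow_in_tensor_space subspace_tensor_space)

lemma tensor_space_basis:
  fixes p :: nat
  defines "B \<equiv> (\<lambda>ks. Poly_Mapping.single ks 1) ` (sorted_tuples p :: 'd::{finite,linorder} list set)"
  shows "independent B" "span B = (tensor_space p :: ('d list \<Rightarrow>\<^sub>0 real) set)"
    "finite B" "card B = card (sorted_tuples p :: 'd list set)"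
proof -
  let ?T = "sorted_tuples p :: 'd list set"
  let ?e = "\<lambda>ks :: 'd list. Poly_Mapping.single ks (1::real)"
  have inj: "inj_on ?e ?T"
    by (rule inj_onI) (metis lookup_single_eq lookup_single_not_eq zero_neq_one)
  show fin: "finite B" and "card B = card ?T"
    using inj by (auto simp: B_def finite_sorted_tuples card_image)
  have coord: "Poly_Mapping.lookup (\<Sum>ks\<in>?T. c ks *\<^sub>R ?e ks) l = (if l \<in> ?T then c l else 0)"
    for c l
  proof -
    have "Poly_Mapping.lookup (\<Sum>ks\<in>?T. c ks *\<^sub>R ?e ks) l
        = (\<Sum>ks\<in>?T. if ks = l then c ks else 0)"
      unfolding lookup_sum lookup_scaleR_poly_mapping
      by (rule sum.cong) (auto simp: lookup_single)
    then show ?thesis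
      by (simp add: finite_sorted_tuples)
  qed
  show "independent B"
  proof (rule independent_if_scalars_zero[OF fin])
    fix f x assume 0: "(\<Sum>x\<in>B. f x *\<^sub>R x) = 0" and "x \<in> B"
    then obtain l where l: "l \<in> ?T" "x = ?e l"
      by (auto simp: B_def)
    have "(\<Sum>ks\<in>?T. f (?e ks) *\<^sub>R ?e ks) = 0"
      using 0 inj by (simp add: B_def sum.reindex)
    then show "f x = 0"
      using coord[of "\<lambda>ks. f (?e ks)" l] l by simp
  qed
  show "span B = tensor_space p"
  proof
    show "span B \<subseteq> tensor_space p"
      by (rule span_minimal[OF _ subspace_tensor_space]) (auto simp: B_def tensor_space_def)
    show "tensor_space p \<subseteq> span B"
    proof
      fix f :: "'d list \<Rightarrow>\<^sub>0 real" assume "f \<in> tensor_space p"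
      then have "f = (\<Sum>ks\<in>?T. Poly_Mapping.lookup f ks *\<^sub>R ?e ks)"
        by (intro poly_mapping_eqI) (auto simp: coord tensor_space_def in_keys_iff)
      moreover have "\<dots> \<in> span B"
        by (intro span_sum span_scale span_base) (auto simp: B_def)
      ultimately show "f \<in> span B" by simp
    qed
  qed
qed

lemma dim_tensor_space:
  "dim (tensor_space p :: ('d::{finite,linorder} list \<Rightarrow>\<^sub>0 real) set) = (CARD('d) + p - 1) choose p"
proof -
  let ?B = "(\<lambda>ks. Poly_Mapping.single ks (1::real)) ` (sorted_tuples p :: 'd list set)"
  have "dim (tensor_space p :: ('d list \<Rightarrow>\<^sub>0 real) set) = dim (span ?B)"
    by (simp only: tensor_space_basis)
  also have "\<dots> = card ?B"
    by (simp only: dim_span dim_eq_card_independent[OF tensor_space_basis(1)])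
  finally show ?thesis
    by (simp only: tensor_space_basis card_sorted_tuples)
qed

text \<open>
  The type of finitely supported functions is infinite-dimensional, and \<^const>\<open>dim\<close> is \<open>0\<close> by
  convention on infinite-dimensional sets.  That convention never applies to a tensorized
  subspace:
\<close>

lemma tensorized_subspace_finite_basis:
  "\<exists>B. finite B \<and> independent B \<and> span B = tensorized_subspace p V \<and>
       card B = dim (tensorized_subspace p V)"
proof -
  let ?S = "tensorized_subspace p V"
  obtain B where B: "B \<subseteq> ?S" "independent B" "?S \<subseteq> span B" "card B = dim ?S"
    using basis_exists by blast
  have "span B = ?S"
    using B(1,3) span_minimal[OF B(1)] by (auto simp: tensorized_subspace_def)
  moreover have "finite B"
    using independent_span_bound[OF tensor_space_basis(3) B(2)] B(1) tensorized_subspace_subset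
      tensor_space_basis(2) by blast
  ultimately show ?thesis
    using B by blast
qed

end

theory Submission
  imports Defs
begin

text \<open>
  Expanding the product over \<open>ks\<close> of the \<open>k\<close>-th coordinates of \<open>x = \<Sum>b\<in>B. c b *\<^sub>R b\<close> and grouping
  the factors by which basis vectors were chosen, \<open>tensor_pow p x\<close> becomes a linear combination
  of vectors that depend only on the multiset of chosen basis vectors, not on \<open>c\<close>. There are
  \<open>(r + p - 1) choose p\<close> multisets of size \<open>p\<close> over a basis of an \<open>r\<close>-dimensional subspace.
\<close>

text \<open>Distributivity: the list \<open>bs\<close> records which summand is chosen in each
  factor, and the induction splits off the choice made in the first factor.\<close>

lemma prod_list_sum_expand:
  fixes f :: "'b \<Rightarrow> 'k \<Rightarrow> 'a::comm_semiring_1"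
  assumes "finite B"
  shows "(\<Prod>k\<leftarrow>ks. \<Sum>b\<in>B. f b k)
       = (\<Sum>bs | set bs \<subseteq> B \<and> length bs = length ks. prod_list (map2 f bs ks))"
proof (induction ks)
  case Nil
  have "{bs. set bs \<subseteq> B \<and> length bs = length ([] :: 'k list)} = {[]}"
    by auto
  then show ?case by simp
next
  case (Cons k ks)
  let ?L = "{bs. set bs \<subseteq> B \<and> length bs = length ks}"
  have L: "{bs. set bs \<subseteq> B \<and> length bs = length (k # ks)} = (\<lambda>(b, bs). b # bs) ` (B \<times> ?L)"
    by (auto simp: length_Suc_conv image_iff)
  have inj: "inj_on (\<lambda>(b, bs). b # bs) (B \<times> ?L)"
    by (auto simp: inj_on_def)
  show ?case
    unfolding L sum.reindex[OF inj]
    by (simp add: Cons.IH sum_product sum.cartesian_product split_def)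
qed

text \<open>For \<open>M\<close> of size \<open>p\<close> this is, up to a nonzero scalar, the
  symmetrized tensor product of the members of \<open>M\<close>, read off at sorted index tuples.
  Building it from \<open>Poly_Mapping.single\<close> makes its support finite by
  construction.\<close>

definition sym_tensor :: "nat \<Rightarrow> (real ^ 'd::{finite,linorder}) multiset \<Rightarrow> ('d list \<Rightarrow>\<^sub>0 real)" where
  "sym_tensor p M = (\<Sum>ks\<in>sorted_tuples p.
     Poly_Mapping.single ks (\<Sum>bs | mset bs = M. prod_list (map2 ($) bs ks)))"

lemma lookup_sym_tensor:
  "Poly_Mapping.lookup (sym_tensor p M) ks =
     (if ks \<in> sorted_tuples p then \<Sum>bs | mset bs = M. prod_list (map2 ($) bs ks) else 0)"
  by (simp add: sym_tensor_def lookup_sum lookup_single when_def finite_sorted_tuples)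

text \<open>The scalars commute, so their product sees only the multiset of choices; this is what
  permits grouping.\<close>

lemma prod_list_map2_scaled:
  fixes c :: "(real ^ 'd::{finite,linorder}) \<Rightarrow> real"
  assumes "length bs = length ks"
  shows "prod_list (map2 (\<lambda>b k. c b * b $ k) bs ks)
       = prod_mset (image_mset c (mset bs)) * prod_list (map2 ($) bs ks)"
  using assms by (induction bs ks rule: list_induct2) simp_all

text \<open>A multinomial theorem, with the multinomial coefficients absorbed into the sum over
  orderings in \<open>sym_tensor\<close>.\<close>

lemma tensor_pow_sum:
  fixes c :: "(real ^ 'd::{finite,linorder}) \<Rightarrow> real"
  assumes B: "finite B"
  shows "tensor_pow p (\<Sum>b\<in>B. c b *\<^sub>R b)
       = (\<Sum>M\<in>multisets_of_size B p. prod_mset (image_mset c M) *\<^sub>R sym_tensor p M)"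
proof (rule poly_mapping_eqI)
  fix ks :: "'d list"
  let ?L = "{bs. set bs \<subseteq> B \<and> length bs = p}"
  let ?m = "multisets_of_size B p"
  show "Poly_Mapping.lookup (tensor_pow p (\<Sum>b\<in>B. c b *\<^sub>R b)) ks = Poly_Mapping.lookup
      (\<Sum>M\<in>?m. prod_mset (image_mset c M) *\<^sub>R sym_tensor p M) ks"
  proof (cases "ks \<in> sorted_tuples p")
    case True
    then have len: "length ks = p"
      by (simp add: sorted_tuples_def)
    \<comment> \<open>Every ordering of \<open>M\<close> already has entries in \<open>B\<close> and
      length \<open>p\<close>, so a fibre of \<open>mset\<close> on \<open>?L\<close> is the full
      index set used in \<open>sym_tensor\<close>.\<close>
    have fibre: "{bs \<in> ?L. mset bs = M} = {bs. mset bs = M}" if "M \<in> ?m" for M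
      using that by (auto simp: multisets_of_size_def)
    have "(\<Prod>k\<leftarrow>ks. (\<Sum>b\<in>B. c b *\<^sub>R b) $ k)
        = (\<Sum>bs\<in>?L. prod_list (map2 (\<lambda>b k. c b * b $ k) bs ks))"
      by (simp add: prod_list_sum_expand[OF B] len)
    also have "\<dots> = (\<Sum>M\<in>?m. \<Sum>bs | bs \<in> ?L \<and> mset bs = M.
        prod_list (map2 (\<lambda>b k. c b * b $ k) bs ks))"
    proof (rule sum.group[symmetric])
      show "mset ` ?L \<subseteq> ?m"
        by (auto simp: multisets_of_size_def)
    qed (simp_all add: B finite_lists_length_eq finite_multisets_of_size)
    also have "\<dots> = (\<Sum>M\<in>?m. prod_mset (image_mset c M) *
        (\<Sum>bs | mset bs = M. prod_list (map2 ($) bs ks)))"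
    proof (rule sum.cong[OF refl])
      fix M assume M: "M \<in> ?m"
      have "(\<Sum>bs | bs \<in> ?L \<and> mset bs = M. prod_list (map2 (\<lambda>b k. c b * b $ k) bs ks))
          = (\<Sum>bs | bs \<in> ?L \<and> mset bs = M.
               prod_mset (image_mset c M) * prod_list (map2 ($) bs ks))"
        by (rule sum.cong[OF refl]) (auto simp: prod_list_map2_scaled len)
      then show "(\<Sum>bs | bs \<in> ?L \<and> mset bs = M. prod_list (map2 (\<lambda>b k. c b * b $ k) bs ks))
          = prod_mset (image_mset c M) * (\<Sum>bs | mset bs = M. prod_list (map2 ($) bs ks))"
        by (simp only: fibre[OF M] sum_distrib_left)
    qed
    finally show ?thesis
      using True by (simp only: lookup_tensor_pow lookup_sum lookup_scaleR_poly_mapping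
          lookup_sym_tensor if_True)
  next
    case False
    then show ?thesis
      by (simp add: lookup_tensor_pow lookup_sum lookup_scaleR_poly_mapping lookup_sym_tensor)
  qed
qed

text \<open>One \<open>W\<close> serves all of \<open>U\<close>, because the coordinates of a point
  enter only through the scalars of the expansion.\<close>

lemma tensor_pow_subspace_span:
  fixes U :: "(real ^ 'd::{finite,linorder}) set"
  obtains W where "finite W" "card W \<le> (dim U + p - 1) choose p" "tensor_pow p ` U \<subseteq> span W"
proof -
  obtain B where B: "B \<subseteq> U" "independent B" "U \<subseteq> span B" "card B = dim U"
    using basis_exists by blast
  have fin: "finite B"
    using B(2) independent_imp_finite by blast
  let ?W = "sym_tensor p ` multisets_of_size B p"
  show thesis
  proof
    show "finite ?W"
      using fin by (simp add: finite_multisets_of_size)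
    have "card ?W \<le> card (multisets_of_size B p)"
      by (rule card_image_le) (simp add: fin finite_multisets_of_size)
    then show "card ?W \<le> (dim U + p - 1) choose p"
      using fin B(4) by (simp add: card_multisets_of_size)
    show "tensor_pow p ` U \<subseteq> span ?W"
    proof (rule image_subsetI)
      fix x assume "x \<in> U"
      then obtain c where x: "x = (\<Sum>b\<in>B. c b *\<^sub>R b)"
        using B(3) span_finite[OF fin] by auto
      then show "tensor_pow p x \<in> span ?W"
        unfolding x tensor_pow_sum[OF fin] by (intro span_sum span_scale span_base imageI)
    qed
  qed
qed

theorem lemma1:
  fixes K r p :: nat
    and U :: "nat \<Rightarrow> (real ^ 'd::{finite,linorder}) set"
    and V :: "(real ^ 'd::{finite,linorder}) set"
  assumes "K \<ge> 1" and "r \<ge> 1" and "p \<ge> 1" and "r \<le> CARD('d)"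
    and "\<And>i. i < K \<Longrightarrow> subspace (U i)"
    and "\<And>i. i < K \<Longrightarrow> dim (U i) = r"
    and "V = (\<Union>i<K. U i)"
  shows "dim (tensorized_subspace p V)
           \<le> min (K * ((r + p - 1) choose p)) ((CARD('d) + p - 1) choose p)"
proof (rule min.boundedI)
  \<comment> \<open>Keeping \<open>dim (U i)\<close> here lets the choice of \<open>W\<close> range
    over all \<open>i\<close>; it becomes \<open>r\<close> only in the final sum over
    \<open>i < K\<close>.\<close>
  have "\<exists>W. finite W \<and> card W \<le> (dim (U i) + p - 1) choose p \<and> tensor_pow p ` U i \<subseteq> span W" for i
    by (meson tensor_pow_subspace_span)
  then obtain W where W: "\<And>i. finite (W i)" "\<And>i. card (W i) \<le> (dim (U i) + p - 1) choose p"
      "\<And>i. tensor_pow p ` U i \<subseteq> span (W i)"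
    by metis
  have "tensorized_subspace p V \<subseteq> span (\<Union>i<K. W i)"
    unfolding tensorized_subspace_def
  proof (rule span_minimal[OF _ subspace_span], clarify)
    fix x assume "x \<in> V"
    then obtain i where i: "i < K" "x \<in> U i"
      using assms(7) by blast
    have "span (W i) \<subseteq> span (\<Union>i<K. W i)"
      using i(1) by (intro span_mono) blast
    then show "tensor_pow p x \<in> span (\<Union>i<K. W i)"
      using W(3) i(2) by blast
  qed
  then have "dim (tensorized_subspace p V) \<le> card (\<Union>i<K. W i)"
    by (rule dim_le_card) (simp add: W(1))
  also have "\<dots> \<le> (\<Sum>i<K. card (W i))"
    by (rule card_UN_le) simp
  also have "\<dots> \<le> (\<Sum>i<K. (r + p - 1) choose p)"
    using W(2) assms(6) by (intro sum_mono) (metis lessThan_iff)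
  finally show "dim (tensorized_subspace p V) \<le> K * ((r + p - 1) choose p)"
    by simp
  \<comment> \<open>A finite spanning set is used because \<open>dim\<close> is not monotone in an
    infinite-dimensional type, where it may take its default value 0.\<close>
  let ?B = "(\<lambda>ks. Poly_Mapping.single ks (1::real)) ` (sorted_tuples p :: 'd list set)"
  have "dim (tensorized_subspace p V) \<le> card ?B"
    using tensorized_subspace_subset[of p V] tensor_space_basis(2)[where 'd = 'd, of p]
    by (intro dim_le_card) (simp_all add: finite_sorted_tuples)
  then show "dim (tensorized_subspace p V) \<le> (CARD('d) + p - 1) choose p"
    by (simp only: tensor_space_basis card_sorted_tuples)
qed

end
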